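(* Let $G$ be a $d$-regular Ramanujan graph on $n$ vertices with girth $C\log_{d-1} n$. Then every set $S$ of vertices of size $|S| \le n^{\kappa}$, for $\kappa < \frac{C}{4}$, has vertex expansion $\frac{|\Gamma(S)|}{|S|} \ge (1-o_d(1))\,d$.
   Context: A finite $d$-regular graph $G$ on $n$ vertices with adjacency eigenvalues $\lambda_1\ge\lambda_2\ge\dots\ge\lambda_n$ is Ramanujan if $\max\{\lambda_2,-\lambda_n\}\le 2\sqrt{d-1}$. The girth is the length of the shortest cycle. $\Gamma(S)$ is the set of vertices adjacent to some vertex of $S$ (possibly including vertices of $S$), and the vertex expansion of $S$ is $|\Gamma(S)|/|S|$. $o_d(1)$ denotes a quantity tending to $0$ as $d\to\infty$.
   Formalization: Adds that n ≥ (d−1)^K with K depending only on C and κ (complete graphs refute the claim for small n); d ≥ 3, S nonempty, vertices are natural numbers, girth at least C log_{d-1} n, and the o_d(1) term may depend on C and κ. *)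

theory Defs
  imports
    "Graph_Theory.Pair_Digraph"
    "Jordan_Normal_Form.Char_Poly"
    "HOL-Library.Extended_Real"
    Complex_Main
begin

text \<open>
  A finite simple graph is a \<^locale>\<open>pair_graph\<close>: a finite, loop-free digraph whose arc set is a
  symmetric set of pairs, so that each undirected edge is represented by its two orientations.
\<close>

definition regular_graph :: "nat \<Rightarrow> 'a pair_pre_digraph \<Rightarrow> bool" where
  "regular_graph d G \<longleftrightarrow> pair_graph G \<and> (\<forall>v\<in>pverts G. out_degree (with_proj G) v = d)"

definition adjacency_mat :: "'a::linorder pair_pre_digraph \<Rightarrow> real mat" where
  "adjacency_mat G =
    (let vs = sorted_list_of_set (pverts G); n = card (pverts G)
     in mat n n (\<lambda>(i, j). if (vs ! i, vs ! j) \<in> parcs G then 1 else 0))"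

text \<open>
  The eigenvalues in decreasing order, repeated according to multiplicity. The adjacency matrix
  of a graph is real symmetric, so all \<open>n\<close> roots of its characteristic polynomial are real and
  the list has length \<open>n\<close>.
\<close>

definition adjacency_eigenvalues :: "'a::linorder pair_pre_digraph \<Rightarrow> real list" where
  "adjacency_eigenvalues G = rev (sorted_list_of_multiset (proots (char_poly (adjacency_mat G))))"

text \<open>
  Lists are indexed from 0, so the second largest eigenvalue is the entry with index 1. It exists
  once the graph has two vertices, in particular for every nonempty \<open>d\<close>-regular graph with
  \<open>d \<ge> 1\<close>.
\<close>

definition ramanujan :: "nat \<Rightarrow> 'a::linorder pair_pre_digraph \<Rightarrow> bool" where
  "ramanujan d G \<longleftrightarrow> regular_graph d G \<and>
    max (adjacency_eigenvalues G ! 1) (- last (adjacency_eigenvalues G)) \<le> 2 * sqrt (real d - 1)"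

text \<open>
  In a symmetric digraph the library's \<open>cycle\<close> also admits the closed walk \<open>u, v, u\<close> of length 2
  along a single undirected edge. The cycles of length at least 3 are exactly the cycles of the
  undirected graph. The girth of an acyclic graph is \<open>\<infinity>\<close>.
\<close>

definition girth :: "'a pair_pre_digraph \<Rightarrow> enat" where
  "girth G = (INF p \<in> {p. pre_digraph.cycle (with_proj G) p \<and> 3 \<le> length p}. enat (length p))"

definition neighbourhood :: "'a pair_pre_digraph \<Rightarrow> 'a set \<Rightarrow> 'a set" where
  "neighbourhood G S = {v \<in> pverts G. \<exists>u\<in>S. (u, v) \<in> parcs G}"

definition vertex_expansion :: "'a pair_pre_digraph \<Rightarrow> 'a set \<Rightarrow> real" where
  "vertex_expansion G S = real (card (neighbourhood G S)) / real (card S)"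

end

theory Submission
  imports Defs "Graph_Theory.Vertex_Walk" "HOL-Real_Asymp.Real_Asymp"
begin

text \<open>
  Let \<open>b = (d - 1)\<^sup>\<theta>\<close> with \<open>\<theta> < 1\<close>, \<open>\<theta> C / 4 > \<kappa>\<close>, and suppose \<open>|\<Gamma>(S)| < (d - b - 1) |S|\<close>. Among the
  sets of arcs \<open>F \<subseteq> S \<times> \<Gamma>(S)\<close> with more than \<open>|Range F| + (b + 1) |Domain F|\<close> elements, one of least
  cardinality has all left degrees above \<open>b + 1\<close> and all right degrees at least \<open>2\<close>. Hence at
  least \<open>b\<^sup>k\<close> non-backtracking walks of length \<open>2k\<close> in \<open>F\<close> start at a given left vertex. If \<open>4k\<close> is less
  than the girth, they have distinct endpoints in \<open>S\<close>, so \<open>|S| \<ge> b\<^sup>k\<close>; the largest such \<open>k\<close> gives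
  \<open>b\<^sup>k > n\<^sup>\<kappa>\<close>.
\<close>

section \<open>Non-backtracking walks\<close>

fun nb_walk :: "'a rel \<Rightarrow> 'a list \<Rightarrow> bool" where
  "nb_walk E (x # y # z # zs) \<longleftrightarrow> (x, y) \<in> E \<and> x \<noteq> z \<and> nb_walk E (y # z # zs)"
| "nb_walk E [x, y] \<longleftrightarrow> (x, y) \<in> E"
| "nb_walk E _ \<longleftrightarrow> True"

lemma nb_walk_ConsD: "nb_walk E (x # xs) \<Longrightarrow> nb_walk E xs"
  by (cases "(E, x # xs)" rule: nb_walk.cases) auto

lemma nb_walk_appendD1: "nb_walk E (xs @ ys) \<Longrightarrow> nb_walk E xs"
  by (induction E xs rule: nb_walk.induct) (auto split: list.splits elim: nb_walk.elims)

lemma nb_walk_join: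
  assumes "nb_walk E (xs @ [x, y])" "nb_walk E (y # z # zs)" "x \<noteq> z"
  shows "nb_walk E (xs @ x # y # z # zs)"
  using assms
proof (induction xs)
  case (Cons u us)
  then show ?case by (cases us; cases "tl us") auto
qed auto

lemma nb_walk_rev:
  assumes "sym E" "nb_walk E xs"
  shows "nb_walk E (rev xs)"
  using assms
proof (induction E xs rule: nb_walk.induct)
  case (1 E x y z zs)
  then have "(y, x) \<in> E" by (auto dest: symD)
  then show ?case
    using 1 nb_walk_join[of E "rev zs" z y "x" "[]"] by auto
qed (auto dest: symD)

lemma nb_walk_arcs: "nb_walk E xs \<Longrightarrow> set (vwalk_arcs xs) \<subseteq> E"
  by (induction E xs rule: nb_walk.induct) auto

text \<open>The shortest suffix with a repetition has a distinct tail in which its head recurs;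
  cutting it at that recurrence leaves a closed walk without other repetitions.\<close>

lemma nb_walk_not_distinct:
  assumes "nb_walk E xs" "\<not> distinct xs"
  obtains x ys where "nb_walk E (x # ys @ [x])" "distinct (x # ys)" "length ys + 2 \<le> length xs"
  using assms
proof (induction xs arbitrary: thesis)
  case (Cons x xs)
  show ?case
  proof (cases "distinct xs")
    case True
    then obtain ys zs where xs: "xs = ys @ x # zs"
      using Cons.prems(3) by (auto dest: split_list)
    have "nb_walk E (x # ys @ [x])"
      using Cons.prems(2) nb_walk_appendD1[of E "x # ys @ [x]" zs] by (simp add: xs)
    then show ?thesis using Cons.prems(1) True by (auto simp: xs)
  next
    case False
    then show ?thesis
      using Cons.IH Cons.prems(1,2) nb_walk_ConsD by (metis le_SucI length_Cons)
  qed
qed simp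

text \<open>
  If the last steps of the two walks differ, following one of them and returning along the other
  is non-backtracking at the common endpoint, and at the common root this is not required.
\<close>

lemma nb_walks_same_ends:
  assumes "sym E" "nb_walk E p" "nb_walk E q" "length p = length q" "p \<noteq> q"
    and "hd p = hd q" "last p = last q"
  obtains x ys where "nb_walk E (x # ys @ [x])" "distinct (x # ys)"
    "length ys + 3 \<le> 2 * length p"
  using assms(2-)
proof (induction p arbitrary: q thesis)
  case (Cons y p)
  obtain q' where q: "q = y # q'" "length q' = length p"
    using Cons.prems by (cases q) auto
  with Cons.prems obtain u p' where p: "p = u # p'" by (cases p) auto
  with q obtain v q'' where q': "q' = v # q''" by (cases q') auto
  show ?case
  \<comment> \<open>The root is the last list entry, so the last steps seen from the root are the
    first arcs here. A shared first arc is dropped; otherwise \<open>u \<noteq> v\<close> is the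
    condition for turning around at \<open>y\<close>.\<close>
  proof (cases "u = v")
    case True
    have *: "nb_walk E p" "nb_walk E q'" "p \<noteq> q'" "hd p = hd q'" "last p = last q'"
      using Cons.prems nb_walk_ConsD unfolding q p q' True by auto
    show ?thesis
    proof (rule Cons.IH[OF _ *(1,2) q(2)[symmetric] *(3-5)])
      fix x ys
      assume "nb_walk E (x # ys @ [x])" "distinct (x # ys)" "length ys + 3 \<le> 2 * length p"
      then show thesis by (intro Cons.prems(1)) auto
    qed
  next
    case False
    let ?w = "rev p' @ u # y # v # q''"
    have "nb_walk E (rev p' @ [u, y])"
      using nb_walk_rev[OF assms(1) Cons.prems(2)] by (simp add: p)
    then have nb: "nb_walk E ?w"
      using nb_walk_join Cons.prems(3) False by (auto simp: q q')
    have "hd (rev p' @ [u]) = last (v # q'')"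
      using Cons.prems(7) by (simp add: q p q' hd_append hd_rev split: if_splits)
    then have "\<not> distinct ?w"
      by (cases p' rule: rev_cases) (auto simp: last_in_set split: if_splits)
    from nb_walk_not_distinct[OF nb this] obtain x ys where
      "nb_walk E (x # ys @ [x])" "distinct (x # ys)" "length ys + 2 \<le> length ?w" .
    then show ?thesis using q(2) by (intro Cons.prems(1)) (auto simp: p q')
  qed
qed simp

section \<open>Closed walks and the girth\<close>

lemma pcas_vwalk_arcs: "pcas x (vwalk_arcs (x # xs)) (last (x # xs))"
  by (induction xs arbitrary: x) auto

lemma pawalk_verts_vwalk_arcs: "pawalk_verts x (vwalk_arcs (x # xs)) = x # xs"
  by (induction xs arbitrary: x) auto

lemma (in pair_graph) girth_le_closed_nb_walk:
  assumes "nb_walk (parcs G) (x # ys @ [x])" "distinct (x # ys)"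
  shows "girth G \<le> enat (length ys + 1)"
proof -
  let ?p = "vwalk_arcs (x # ys @ [x])"
  have len: "length ?p = length ys + 1"
    using vwalk_length_simp[of "x # ys @ [x]"] unfolding vwalk_length_def by simp
  have arcs: "set ?p \<subseteq> parcs G" by (rule nb_walk_arcs[OF assms(1)])
  \<comment> \<open>The girth counts only cycles with at least three arcs. An empty
    \<open>ys\<close> would give a loop, and \<open>ys = [y]\<close> the walk x, y, x, which
    backtracks at y.\<close>
  have "length ys \<ge> 2"
  proof (rule ccontr)
    assume "\<not> ?thesis"
    then consider "ys = []" | y where "ys = [y]"
      by (cases ys; cases "tl ys") auto
    then show False using assms(1) pair_no_loops by cases (auto dest: no_loops')
  qed
  moreover have "x \<in> pverts G" using arcs by (cases ys) (auto dest: arc_fst_in_verts)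
  then have "awalk x ?p x"
    using pcas_vwalk_arcs[of x "ys @ [x]"] arcs by (simp add: awalk_def)
  moreover have "distinct (tl (pawalk_verts x ?p))"
    using assms(2) by (subst pawalk_verts_vwalk_arcs) auto
  moreover have "?p \<noteq> []" using len by force
  ultimately have "cycle ?p" "3 \<le> length ?p"
    using len by (auto simp: cycle_def)
  then show ?thesis unfolding girth_def len[symmetric] by (intro INF_lower) auto
qed

section \<open>The dense core and the Moore bound\<close>

text \<open>By minimality every deletion must destroy the inequality. Deleting all arcs at a left
  vertex lowers the right-hand side by at least \<open>a\<close>, so more than \<open>a\<close> arcs
  must go. Deleting the only arc into \<open>y\<close> would lower \<open>card F'\<close> and
  \<open>card (Range F')\<close> by one each and preserve the inequality.\<close>

lemma bipartite_core:
  fixes a :: real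
  assumes "finite F" "a \<ge> 0" "card F > card (Range F) + a * card (Domain F)"
  obtains F' where "F' \<subseteq> F" "F' \<noteq> {}"
    "\<forall>x\<in>Domain F'. card (F' `` {x}) > a"
    "\<forall>x y. (x, y) \<in> F' \<longrightarrow> (\<exists>z. z \<noteq> x \<and> (z, y) \<in> F')"
proof -
  define P where "P F' \<longleftrightarrow> F' \<subseteq> F \<and> card F' > card (Range F') + a * card (Domain F')" for F'
  have "P F" using assms by (simp add: P_def)
  then obtain F' where F': "P F'" and min: "\<And>F''. P F'' \<Longrightarrow> card F' \<le> card F''"
    using ex_has_least_nat[of P F card] by auto
  have sub: "F' \<subseteq> F" and gt: "card F' > card (Range F') + a * card (Domain F')"
    using F' by (auto simp: P_def)
  have fin: "finite F'" using sub assms(1) finite_subset by blast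
  have notP: "card F'' \<le> card (Range F'') + a * card (Domain F'')" if "F'' \<subset> F'" for F''
    using min[of F''] psubset_card_mono[OF fin that] that sub by (force simp: P_def)
  show thesis
  proof (rule that[OF sub]; (intro ballI allI impI)?)
    show "F' \<noteq> {}" using gt by auto
  next
    fix x assume x: "x \<in> Domain F'"
    define F'' where "F'' = F' - {x} \<times> UNIV"
    have "F'' \<subset> F'" using x by (auto simp: F''_def)
    have "F' = F'' \<union> Pair x ` (F' `` {x})" "F'' \<inter> Pair x ` (F' `` {x}) = {}"
      by (auto simp: F''_def)
    then have c: "card F' = card F'' + card (F' `` {x})"
      using fin card_image[of "Pair x" "F' `` {x}"]
      by (metis card_Un_disjoint finite_Un inj_on_def prod.inject)
    have "Domain F'' = Domain F' - {x}" by (auto simp: F''_def)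
    then have "card (Domain F') = card (Domain F'') + 1"
      using x fin by (metis Suc_eq_plus1 card.remove finite_Domain)
    moreover have "card (Range F'') \<le> card (Range F')"
      using fin by (intro card_mono) (auto simp: F''_def finite_Range)
    ultimately show "card (F' `` {x}) > a"
      using notP[OF \<open>F'' \<subset> F'\<close>] gt c by (simp add: algebra_simps)
  next
    fix x y assume xy: "(x, y) \<in> F'"
    show "\<exists>z. z \<noteq> x \<and> (z, y) \<in> F'"
    proof (rule ccontr)
      assume no: "\<not> ?thesis"
      define F'' where "F'' = F' - {(x, y)}"
      have "F'' \<subset> F'" using xy by (auto simp: F''_def)
      have "card F' = card F'' + 1"
        using xy fin by (metis F''_def Suc_eq_plus1 card.remove)
      moreover have "Range F'' = Range F' - {y}" using no by (auto simp: F''_def)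
      then have "card (Range F') = card (Range F'') + 1"
        using xy fin by (metis Range.intros Suc_eq_plus1 card.remove finite_Range)
      moreover have "card (Domain F'') \<le> card (Domain F')"
        using fin by (intro card_mono) (auto simp: F''_def finite_Domain)
      then have "a * card (Domain F'') \<le> a * card (Domain F')"
        using assms(2) by (intro mult_left_mono) auto
      ultimately show False using notP[OF \<open>F'' \<subset> F'\<close>] gt by simp
    qed
  qed
qed

text \<open>Walks grow at the head, two arcs at a time, with the root \<open>x0\<close> kept last.
  Of the at least \<open>b + 1\<close> arcs leaving the head in \<open>F\<close>, at most one leads
  back, so there are at least \<open>b\<close> ways to go on.\<close>

lemma nb_walks_from:
  fixes b :: real
  assumes "sym E" "finite F" "F \<subseteq> E" "x0 \<in> Domain F" "b \<ge> 0"
    and left: "\<And>x. x \<in> Domain F \<Longrightarrow> card (F `` {x}) \<ge> b + 1"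
    and right: "\<And>x y. (x, y) \<in> F \<Longrightarrow> \<exists>z. z \<noteq> x \<and> (z, y) \<in> F"
  shows "\<exists>W. finite W \<and> card W \<ge> b ^ k \<and>
    (\<forall>p\<in>W. nb_walk E p \<and> length p = 2 * k + 1 \<and> last p = x0 \<and> hd p \<in> Domain F)"
proof (induction k)
  case 0
  show ?case using assms(4) by (intro exI[of _ "{[x0]}"]) auto
next
  case (Suc k)
  then obtain W where W: "finite W" "card W \<ge> b ^ k"
    "\<And>p. p \<in> W \<Longrightarrow> nb_walk E p \<and> length p = 2 * k + 1 \<and> last p = x0 \<and> hd p \<in> Domain F"
    by blast
  \<comment> \<open>One fixed continuation from each right vertex suffices, since only the choices
    at left vertices are counted.\<close>
  obtain g where g: "\<And>x y. (x, y) \<in> F \<Longrightarrow> g x y \<noteq> x \<and> (g x y, y) \<in> F"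
    using right by metis
  \<comment> \<open>\<open>take 1 (tl p)\<close> holds the vertex visited just before the head; it
    is empty for the trivial walk \<open>[x0]\<close>, where nothing is excluded.\<close>
  define Y where "Y p = F `` {hd p} - set (take 1 (tl p))" for p
  define W' where "W' = (\<lambda>(p, y). g (hd p) y # y # p) ` Sigma W Y"
  have finY: "finite (Y p)" for p
    using assms(2) by (auto simp: Y_def)
  have cardY: "card (Y p) \<ge> b" if "p \<in> W" for p
  proof -
    have "card (F `` {hd p}) - card (set (take 1 (tl p))) \<le> card (Y p)"
      unfolding Y_def by (rule diff_card_le_card_Diff) simp
    moreover have "card (set (take 1 (tl p))) \<le> 1"
      using card_length[of "take 1 (tl p)"] by simp
    ultimately show ?thesis using left[of "hd p"] W(3)[OF that] by linarith
  qed
  have "b ^ Suc k \<le> card W * b" using W(2) assms(5) by (simp add: mult.commute mult_left_mono)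
  also have "\<dots> \<le> (\<Sum>p\<in>W. real (card (Y p)))"
    using sum_mono[of W "\<lambda>_. b" "\<lambda>p. real (card (Y p))"] cardY by simp
  also have "\<dots> = card (Sigma W Y)" using W(1) finY by (simp add: card_SigmaI)
  also have "\<dots> = card W'"
    unfolding W'_def by (subst card_image) (auto simp: inj_on_def)
  finally have "b ^ Suc k \<le> card W'" .
  moreover have "finite W'" using W(1) finY by (auto simp: W'_def)
  moreover have "nb_walk E w \<and> length w = 2 * Suc k + 1 \<and> last w = x0 \<and> hd w \<in> Domain F"
    if "w \<in> W'" for w
  proof -
    from that obtain p y where p: "p \<in> W" "y \<in> Y p" and w: "w = g (hd p) y # y # p"
      by (auto simp: W'_def)
    obtain x p' where px: "p = x # p'" using W(3)[OF p(1)] by (cases p) auto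
    have F: "(x, y) \<in> F" using p(2) by (simp add: Y_def px)
    have "nb_walk E (y # p)"
    proof (cases p')
      case (Cons z zs)
      then show ?thesis
        using W(3)[OF p(1)] p(2) F assms(1,3) by (auto simp: px Y_def dest: symD)
    qed (use F assms(1,3) in \<open>auto simp: px dest: symD\<close>)
    then have "nb_walk E w" using g[OF F] assms(3) by (auto simp: w px)
    then show ?thesis using W(3)[OF p(1)] g[OF F] by (auto simp: w px)
  qed
  ultimately show ?case by blast
qed

lemma (in pair_graph) power_le_card_if_girth:
  fixes b :: real
  assumes "finite S" "b \<ge> 0" "enat (4 * k) < girth G"
    and "\<And>u. u \<in> S \<Longrightarrow> card {v. (u, v) \<in> parcs G} = d"
    and "card (neighbourhood G S) < (d - (b + 1)) * card S"
  shows "b ^ k \<le> card S"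
proof -
  \<comment> \<open>\<open>F\<close> is read as a bipartite graph between \<open>S\<close> and its
    neighbourhood: a vertex lying in both counts once on each side, while the walks live in
    \<open>G\<close> itself.\<close>
  define F where "F = parcs G \<inter> S \<times> UNIV"
  have finF: "finite F" unfolding F_def using pair_finite_arcs by blast
  have symE: "sym (parcs G)" using pair_sym_arcs by (simp add: symmetric_def)
  have "F = Sigma S (\<lambda>u. {v. (u, v) \<in> parcs G})" by (auto simp: F_def)
  moreover have "finite {v. (u, v) \<in> parcs G}" for u
    using finite_Image[OF pair_finite_arcs, of "{u}"] by (simp add: Image_def)
  ultimately have "card F = card S * d"
    using assms(1,4) by (simp add: card_SigmaI)
  moreover have "Range F = neighbourhood G S"
    using arc_snd_in_verts by (force simp: F_def neighbourhood_def)
  moreover have "card (Domain F) \<le> card S"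
    using assms(1) by (intro card_mono) (auto simp: F_def)
  then have "(b + 1) * card (Domain F) \<le> (b + 1) * card S"
    using assms(2) by (intro mult_left_mono) auto
  ultimately have dense: "card F > card (Range F) + (b + 1) * card (Domain F)"
    using assms(5) by (simp add: algebra_simps)
  have "b + 1 \<ge> 0" using assms(2) by simp
  obtain F' where F': "F' \<subseteq> F" "F' \<noteq> {}"
    "\<forall>x\<in>Domain F'. card (F' `` {x}) > b + 1"
    "\<forall>x y. (x, y) \<in> F' \<longrightarrow> (\<exists>z. z \<noteq> x \<and> (z, y) \<in> F')"
    using bipartite_core[OF finF \<open>b + 1 \<ge> 0\<close> dense] by blast
  obtain x0 where "x0 \<in> Domain F'" using F'(2) by auto
  moreover have "finite F'" using F'(1) finF by (rule finite_subset)
  moreover have "F' \<subseteq> parcs G" using F'(1) by (auto simp: F_def)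
  ultimately obtain W where W: "finite W" "card W \<ge> b ^ k"
    "\<And>p. p \<in> W \<Longrightarrow> nb_walk (parcs G) p \<and> length p = 2 * k + 1 \<and> last p = x0 \<and> hd p \<in> Domain F'"
    using nb_walks_from[OF symE, of F' x0 b k] assms(2) F'(3,4) by (metis less_imp_le)
  \<comment> \<open>Two walks of 2k arcs from \<open>x0\<close> with the same endpoint would give a
    cycle of length at most 4k, below the girth.\<close>
  have "inj_on hd W"
  proof (rule inj_onI, rule ccontr)
    fix p q assume pq: "p \<in> W" "q \<in> W" "hd p = hd q" "p \<noteq> q"
    from nb_walks_same_ends[OF symE, of p q] W(3)[OF pq(1)] W(3)[OF pq(2)] pq(3,4)
    obtain x ys where c: "nb_walk (parcs G) (x # ys @ [x])" "distinct (x # ys)"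
      "length ys + 3 \<le> 2 * length p" by metis
    have "girth G \<le> enat (length ys + 1)" by (rule girth_le_closed_nb_walk[OF c(1,2)])
    also have "\<dots> \<le> enat (4 * k)" using c(3) W(3)[OF pq(1)] by simp
    finally show False using assms(3) by simp
  qed
  then have "card W \<le> card S"
    using W(3) F'(1) assms(1) by (intro card_inj_on_le[of hd]) (auto simp: F_def)
  then show ?thesis using W(2) by linarith
qed

section \<open>Choice of the parameters\<close>

lemma tendsto_powr_over_self:
  assumes "0 < \<theta>" "\<theta> < (1 :: real)"
  shows "(\<lambda>d. ((real d - 1) powr \<theta> + 1) / real d) \<longlonglongrightarrow> 0"
  using assms by real_asymp

theorem theorem1p2:
  fixes C \<kappa> :: real
  assumes "0 < C" and "\<kappa> < C / 4"
  shows "\<exists>(\<delta> :: nat \<Rightarrow> real) (K :: real). \<delta> \<longlonglongrightarrow> 0 \<and>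
    (\<forall>(d :: nat) (n :: nat) (G :: nat pair_pre_digraph) (S :: nat set).
      3 \<le> d \<longrightarrow> K \<le> log (real d - 1) (real n) \<longrightarrow>
      ramanujan d G \<longrightarrow> card (pverts G) = n \<longrightarrow>
      ereal (C * log (real d - 1) (real n)) \<le> ereal_of_enat (girth G) \<longrightarrow>
      S \<subseteq> pverts G \<longrightarrow> S \<noteq> {} \<longrightarrow> real (card S) \<le> real n powr \<kappa> \<longrightarrow>
      vertex_expansion G S \<ge> (1 - \<delta> d) * real d)"
proof -
  \<comment> \<open>The maximum with 0 keeps \<theta> positive even if \<kappa> is negative.\<close>
  have "max 0 (4 * \<kappa> / C) < 1" using assms by (simp add: field_simps)
  then obtain \<theta> where "max 0 (4 * \<kappa> / C) < \<theta>" and \<theta>1: "\<theta> < 1" using dense by blast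
  then have \<theta>0: "0 < \<theta>" and \<theta>: "\<kappa> < \<theta> * C / 4" using assms(1) by (auto simp: field_simps)
  \<comment> \<open>Chosen so that \<open>(1 - \<delta> d) * real d\<close> equals
    \<open>d - (b + 1)\<close>.\<close>
  define \<delta> where "\<delta> d = ((real d - 1) powr \<theta> + 1) / real d" for d :: nat
  \<comment> \<open>With \<open>L\<close> the logarithm of \<open>n\<close> to base
    \<open>d - 1\<close>, the quotient is the value of \<open>L\<close> at which
    \<open>\<theta> * (C * L / 4 - 1)\<close> equals \<open>\<kappa> * L\<close>, the -1 being the
    rounding loss in \<open>k\<close>. The added 1 makes the inequality strict.\<close>
  define K where "K = 1 + \<theta> / (\<theta> * C / 4 - \<kappa>)"
  have "K > 0" using \<theta> \<theta>0 by (simp add: K_def add_pos_pos)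
  have "(1 - \<delta> d) * real d \<le> vertex_expansion G S"
    if d: "3 \<le> d" and K: "K \<le> log (real d - 1) (real n)" and G: "ramanujan d G"
      and n: "card (pverts G) = n"
      and girth: "ereal (C * log (real d - 1) (real n)) \<le> ereal_of_enat (girth G)"
      and S: "S \<subseteq> pverts G" "S \<noteq> {}" "real (card S) \<le> real n powr \<kappa>"
    for d n :: nat and G :: "nat pair_pre_digraph" and S :: "nat set"
  proof (rule ccontr)
    assume neg: "\<not> ?thesis"
    have "pair_graph G" and reg: "\<And>v. v \<in> pverts G \<Longrightarrow> out_degree (with_proj G) v = d"
      using G by (auto simp: ramanujan_def regular_graph_def)
    interpret pair_graph G by fact
    define L where "L = log (real d - 1) (real n)"
    define b where "b = (real d - 1) powr \<theta>"
    \<comment> \<open>The largest integer with 4k strictly below \<open>C * L\<close>; strictness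
      matters because the girth may equal \<open>C * L\<close>.\<close>
    define k where "k = nat \<lceil>C * L / 4\<rceil> - 1"
    have "L > 0" using K \<open>K > 0\<close> by (simp add: L_def)
    \<comment> \<open>By convention \<open>ln 0 = 0\<close>, so \<open>n = 0\<close> would give
      \<open>L = 0\<close>.\<close>
    have "n > 0" using \<open>L > 0\<close> by (cases "n = 0") (auto simp: L_def log_def)
    then have n_eq: "real n = (real d - 1) powr L" using d by (simp add: L_def)
    have finS: "finite S" using S(1) finite_subset pair_finite_verts by blast
    have "C * L > 0" using assms(1) \<open>L > 0\<close> by simp
    then have k1: "4 * real k < C * L" and k2: "real k \<ge> C * L / 4 - 1"
      unfolding k_def by linarith+
    have "ereal (real (4 * k)) < ereal_of_enat (girth G)"
      using k1 girth less_le_trans[of "ereal (real (4 * k))" "ereal (C * L)"] by (simp add: L_def)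
    then have "enat (4 * k) < girth G" by (cases "girth G") auto
    moreover have "card {v. (u, v) \<in> parcs G} = d" if "u \<in> S" for u
    proof -
      have "out_arcs (with_proj G) u = Pair u ` {v. (u, v) \<in> parcs G}"
        by (auto simp: out_arcs_def)
      then have "out_degree (with_proj G) u = card {v. (u, v) \<in> parcs G}"
        by (simp add: out_degree_def card_image inj_on_def)
      then show ?thesis using reg that S(1) by auto
    qed
    moreover have "(1 - \<delta> d) * real d = real d - (b + 1)"
      using d by (simp add: \<delta>_def b_def field_simps)
    then have "card (neighbourhood G S) < (real d - (b + 1)) * card S"
      using neg S(2) finS
      by (simp add: vertex_expansion_def not_le divide_less_eq card_gt_0_iff)
    ultimately have "b ^ k \<le> card S"
      using power_le_card_if_girth[of S b k d] finS by (simp add: b_def)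
    have "\<theta> / (\<theta> * C / 4 - \<kappa>) < L" using K by (simp add: K_def L_def)
    then have "\<theta> < L * (\<theta> * C / 4 - \<kappa>)" using \<theta> by (simp add: divide_less_eq)
    then have "L * \<kappa> < \<theta> * (C * L / 4 - 1)" by (simp add: algebra_simps)
    also have "\<dots> \<le> \<theta> * k" using k2 \<theta>0 by (intro mult_left_mono) auto
    finally have "real n powr \<kappa> < (real d - 1) powr (\<theta> * k)"
      using d by (simp add: n_eq powr_powr)
    also have "\<dots> = b ^ k" using d by (simp add: b_def powr_powr flip: powr_realpow)
    finally show False using \<open>b ^ k \<le> card S\<close> S(3) by linarith
  qed
  moreover have "\<delta> \<longlonglongrightarrow> 0" unfolding \<delta>_def by (rule tendsto_powr_over_self[OF \<theta>0 \<theta>1])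
  ultimately show ?thesis by blast
qed

end
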